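(* Every unit veto interval (UVI) graph has a proper vertex coloring with at most 4 colors.
   Context: A veto interval is a triple $I(a)=(a_l,a_v,a_r)$ of reals with $a_l<a_v<a_r$. A veto interval representation of a graph $G$ assigns to each vertex $a$ a veto interval $I(a)$ such that distinct vertices $a,b$ are adjacent if and only if $a_v<b_l<a_r<b_v$ or $b_v<a_l<b_r<a_v$. The representation is unit if all intervals $[a_l,a_r]$ have the same length; a graph is a UVI graph if it has a unit veto interval representation. *)

theory Defs
  imports Complex_Main "Graph_Theory.Graph_Theory"
begin

text \<open>
  A simple graph is a \<^locale>\<open>pair_bidirected_digraph\<close>: a symmetric, loop-free set of vertex pairs.
  The vertex set is not required to be finite.
\<close>

record interval_triple =
  left_end :: real
  veto_mark :: real
  right_end :: real

definition veto_interval :: "interval_triple \<Rightarrow> bool" where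
  "veto_interval A \<longleftrightarrow> left_end A < veto_mark A \<and> veto_mark A < right_end A"

definition veto_adjacent :: "interval_triple \<Rightarrow> interval_triple \<Rightarrow> bool" where
  "veto_adjacent A B \<longleftrightarrow>
     (veto_mark A < left_end B \<and> left_end B < right_end A \<and> right_end A < veto_mark B) \<or>
     (veto_mark B < left_end A \<and> left_end A < right_end B \<and> right_end B < veto_mark A)"

definition veto_representation :: "'a pair_pre_digraph \<Rightarrow> ('a \<Rightarrow> interval_triple) \<Rightarrow> bool" where
  "veto_representation G I \<longleftrightarrow>
     (\<forall>a \<in> pverts G. veto_interval (I a)) \<and>
     (\<forall>a \<in> pverts G. \<forall>b \<in> pverts G. a \<noteq> b \<longrightarrow>
        ((a, b) \<in> parcs G \<longleftrightarrow> veto_adjacent (I a) (I b)))"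

definition unit_veto_representation :: "'a pair_pre_digraph \<Rightarrow> ('a \<Rightarrow> interval_triple) \<Rightarrow> bool" where
  "unit_veto_representation G I \<longleftrightarrow> veto_representation G I \<and>
     (\<forall>a \<in> pverts G. \<forall>b \<in> pverts G.
        right_end (I a) - left_end (I a) = right_end (I b) - left_end (I b))"

definition UVI_graph :: "'a pair_pre_digraph \<Rightarrow> bool" where
  "UVI_graph G \<longleftrightarrow> pair_bidirected_digraph G \<and> (\<exists>I. unit_veto_representation G I)"

definition proper_vertex_coloring :: "'a pair_pre_digraph \<Rightarrow> ('a \<Rightarrow> 'c) \<Rightarrow> bool" where
  "proper_vertex_coloring G c \<longleftrightarrow>
     (\<forall>a \<in> pverts G. \<forall>b \<in> pverts G. (a, b) \<in> parcs G \<longrightarrow> c a \<noteq> c b)"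

end

theory Submission
  imports Defs
begin

text \<open>
  Rescale so that all intervals have length 1. Every half-open interval \<open>[l, l + 1)\<close> contains
  exactly one integer \<open>n\<close>; colour the interval by the parity of \<open>n\<close> and by whether its veto mark lies
  to the left of \<open>n\<close>. The integers of two adjacent intervals differ by at most 1, and if they are
  equal, then the veto mark of the left interval lies before \<open>n\<close> and that of the right one after \<open>n\<close>.
\<close>

text \<open>Instead of rescaling, the grid of multiples of \<open>d\<close> is used: for
  \<open>d > 0\<close> the ceiling picks the only multiple of \<open>d\<close> in the half-open
  interval of length \<open>d\<close> starting at \<open>left_end A\<close>.\<close>

definition grid_index :: "real \<Rightarrow> interval_triple \<Rightarrow> int" where
  "grid_index d A = \<lceil>left_end A / d\<rceil>"

definition veto_color :: "real \<Rightarrow> interval_triple \<Rightarrow> nat" where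
  "veto_color d A =
     2 * nat (grid_index d A mod 2) + (if veto_mark A < d * of_int (grid_index d A) then 1 else 0)"

lemma veto_color_le: "veto_color d A \<le> 3"
  unfolding veto_color_def by (simp add: mod_2_eq_odd)

lemma veto_color_eqD:
  assumes "veto_color d A = veto_color d B"
  shows "even (grid_index d A) = even (grid_index d B)"
    and "veto_mark A < d * of_int (grid_index d A) \<longleftrightarrow> veto_mark B < d * of_int (grid_index d B)"
  using assms unfolding veto_color_def mod_2_eq_odd
  by (cases "even (grid_index d A)"; cases "even (grid_index d B)"; simp split: if_splits)+

lemma grid_index_bounds:
  assumes "d > 0"
  shows "left_end A \<le> d * of_int (grid_index d A)"
    and "d * of_int (grid_index d A) < left_end A + d"
proof -
  have "left_end A / d \<le> of_int (grid_index d A)" "of_int (grid_index d A) < left_end A / d + 1"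
    unfolding grid_index_def by linarith+
  then show "left_end A \<le> d * of_int (grid_index d A)"
    and "d * of_int (grid_index d A) < left_end A + d"
    using assms by (simp_all add: field_simps)
qed

lemma veto_color_neq_left:
  assumes d: "d > 0" and A: "veto_interval A" "right_end A - left_end A = d"
    and B: "veto_interval B" "right_end B - left_end B = d"
    and less: "veto_mark A < left_end B" "left_end B < right_end A" "right_end A < veto_mark B"
  shows "veto_color d A \<noteq> veto_color d B"
proof
  assume eq: "veto_color d A = veto_color d B"
  let ?m = "grid_index d A" and ?n = "grid_index d B"
  note bounds = grid_index_bounds[OF d, of A] grid_index_bounds[OF d, of B]
  have "left_end A < left_end B" using A less by (simp add: veto_interval_def)
  \<comment> \<open>With \<open>p\<close> and \<open>q\<close> the grid points of \<open>A\<close>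
    and \<open>B\<close>: \<open>p < left_end A + d < left_end B + d \<le> q + d\<close> and
    \<open>q < left_end B + d < right_end A + d = left_end A + 2 * d \<le> p + 2 * d\<close>. Hence
    \<open>?n\<close> is \<open>?m\<close> or \<open>?m + 1\<close>, and parity decides.\<close>
  then have "d * of_int ?m < d * of_int (?n + 1)" "d * of_int ?n < d * of_int (?m + 2)"
    using bounds A less by (simp_all add: distrib_left)
  then have "?m < ?n + 1" "?n < ?m + 2"
    using d by (simp_all only: mult_less_cancel_left_pos of_int_less_iff)
  moreover have "even ?m = even ?n" using veto_color_eqD(1)[OF eq] .
  ultimately have "?m = ?n" by presburger
  \<comment> \<open>At the common grid point \<open>p\<close>,
    \<open>veto_mark A < left_end B \<le> p < right_end A < veto_mark B\<close>, so the marks lie on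
    different sides of \<open>p\<close>.\<close>
  then show False using veto_color_eqD(2)[OF eq] bounds A less by auto
qed

lemma veto_color_neq:
  assumes "d > 0" "veto_interval A" "right_end A - left_end A = d"
    "veto_interval B" "right_end B - left_end B = d" "veto_adjacent A B"
  shows "veto_color d A \<noteq> veto_color d B"
  using veto_color_neq_left[of d A B] veto_color_neq_left[of d B A] assms
  unfolding veto_adjacent_def by metis

theorem theorem21:
  fixes G :: "'a pair_pre_digraph"
  assumes "UVI_graph G"
  shows "\<exists>c :: 'a \<Rightarrow> nat. proper_vertex_coloring G c \<and>
           finite (c ` pverts G) \<and> card (c ` pverts G) \<le> 4"
proof -
  obtain I where G: "pair_bidirected_digraph G" and I: "unit_veto_representation G I"
    using assms unfolding UVI_graph_def by blast
  \<comment> \<open>Without vertices \<open>d\<close> is arbitrary, so its positivity is derived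
    only later, from the endpoint of an edge.\<close>
  obtain d where d: "\<And>a. a \<in> pverts G \<Longrightarrow> right_end (I a) - left_end (I a) = d"
    using I unfolding unit_veto_representation_def by metis
  define c where "c a = veto_color d (I a)" for a
  have "c a \<noteq> c b" if a: "a \<in> pverts G" and b: "b \<in> pverts G" and ab: "(a, b) \<in> parcs G" for a b
  proof -
    \<comment> \<open>The representation describes adjacency of distinct vertices only, so loops are
      excluded first.\<close>
    have "a \<noteq> b"
      using pair_loopfree_digraph.pair_no_loops[OF pair_bidirected_digraph.axioms(2)[OF G] ab] by simp
    then have "veto_interval (I a)" "veto_interval (I b)" "veto_adjacent (I a) (I b)"
      using I a b ab unfolding unit_veto_representation_def veto_representation_def by blast+
    moreover from this have "d > 0" using d[OF a] by (simp add: veto_interval_def)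
    ultimately show ?thesis unfolding c_def using veto_color_neq d a b by blast
  qed
  moreover have "c ` pverts G \<subseteq> {..3}" using veto_color_le by (auto simp: c_def)
  then have "finite (c ` pverts G)" "card (c ` pverts G) \<le> 4"
    using finite_subset card_mono[of "{..3::nat}" "c ` pverts G"] by auto
  ultimately show ?thesis unfolding proper_vertex_coloring_def by blast
qed

end
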